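(* Let $\nu$ be a splitting law, let $(P(u))_{u\in\mathcal T^\infty}$ be i.i.d. with law $\nu$, and let $(Y^u)_{u\in\mathcal T^\infty}$ be i.i.d. with $\mathrm{Dir}_2(\frac12)$ distribution, independent of $(P(u))_{u\in\mathcal T^\infty}$. Let $\mu$ be the a.s. unique random measure on the filled triangle $\tilde T$ such that a.s., for every $u\in\mathcal T^\infty$, $\mu(\tilde T(u))=|I^u|$ and $\mu(\partial\tilde T(u))=0$. Then the atomic part of $\mu$ is a.s. zero; that is, a.s. there is no point $x\in\tilde T$ such that $\mu(\{x\})>0$.
   Context: $A=(0,0)$, $B=(1,0)$, $C=e^{i\pi/3}$ in $\mathbb R^2\cong\mathbb C$; $\tilde T$ is the filled (closed) triangle $ABC$. A splitting law is a probability distribution $\nu$ on $\mathbb R_+^3$ such that if $P=(P_1,P_2,P_3)\sim\nu$ then the law of $P$ is invariant under permutations of coordinates, $P_i>0$ a.s. for each $i$, and $P_1+P_2+P_3=1$ a.s. $\mathcal T^\infty=\bigcup_{n\ge0}\{1,2,3\}^n$ (words; $\emptyset$ is the empty word and $u(i)$ is $u$ with the letter $i$ appended). Triangles. From $(P(u))_{u\in\mathcal T^\infty}$ define for each $u$ an ordered triple of points: $(A_\emptyset,B_\emptyset,C_\emptyset)=(A,B,C)$; $M_u=P_1(u)A_u+P_2(u)B_u+P_3(u)C_u$; the triples of $u(1),u(2),u(3)$ are $(M_u,B_u,C_u)$, $(A_u,M_u,C_u)$, $(A_u,B_u,M_u)$. $\tilde T(u)$ is the filled triangle with vertices $A_u,B_u,C_u$,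 and $\partial\tilde T(u)$ its boundary. Intervals. $\mathrm{Dir}_2(\frac12)$ is the symmetric Dirichlet distribution with parameters $(\frac12,\frac12,\frac12)$ on $\{x\in\mathbb R^3:x_i\ge0,\ x_1+x_2+x_3=1\}$. $I^\emptyset=[0,1)$, and if $I^u=[a,b)$ and $Y^u=(y_1,y_2,y_3)$ then $I^{u(1)}=[a,a+(b-a)y_1)$, $I^{u(2)}=[a+(b-a)y_1,a+(b-a)(y_1+y_2))$, $I^{u(3)}=[a+(b-a)(y_1+y_2),b)$. $|I^u|$ is the length of $I^u$. *)

theory Defs
  imports "HOL-Probability.Probability"
begin

text \<open>
  Letters are the elements 1, 2, 3 of the type \<open>3\<close> (in which the numeral 3 denotes the
  element 0), so that words are exactly the lists over this type. The child \<open>u(i)\<close> of a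
  word \<open>u\<close> is \<open>u @ [i]\<close>.
\<close>

type_synonym word3 = "3 list"

definition splitting_law :: "(real ^ 3) measure \<Rightarrow> bool" where
  "splitting_law \<nu> \<longleftrightarrow>
     prob_space \<nu> \<and> sets \<nu> = sets borel \<and>
     (\<forall>\<sigma>::3 \<Rightarrow> 3. bij \<sigma> \<longrightarrow> distr \<nu> borel (\<lambda>x. \<chi> i. x $ \<sigma> i) = \<nu>) \<and>
     (\<forall>i. AE x in \<nu>. x $ i > 0) \<and>
     (AE x in \<nu>. x $ 1 + x $ 2 + x $ 3 = 1)"

text \<open>
  The Dirichlet distribution with parameters \<open>\<alpha> $ 1\<close>, \<open>\<alpha> $ 2\<close>, \<open>\<alpha> $ 3\<close>. The simplex is
  parametrised by its first two coordinates, with respect to whose Lebesgue measure the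
  density is taken.
\<close>

definition simplex_point :: "real \<times> real \<Rightarrow> real ^ 3" where
  "simplex_point = (\<lambda>(s, t). vector [s, t, 1 - s - t])"

definition dirichlet_density :: "real ^ 3 \<Rightarrow> real ^ 3 \<Rightarrow> real" where
  "dirichlet_density \<alpha> x =
     (if \<forall>i. x $ i > 0
      then Gamma (\<Sum>i\<in>UNIV. \<alpha> $ i) / (\<Prod>i\<in>UNIV. Gamma (\<alpha> $ i)) *
             (\<Prod>i\<in>UNIV. (x $ i) powr (\<alpha> $ i - 1))
      else 0)"

definition dirichlet :: "real ^ 3 \<Rightarrow> (real ^ 3) measure" where
  "dirichlet \<alpha> =
     distr (density lborel (\<lambda>z. ennreal (dirichlet_density \<alpha> (simplex_point z))))
       borel simplex_point"

fun child_triangle :: "real ^ 3 \<Rightarrow> 3 \<Rightarrow> complex \<times> complex \<times> complex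
    \<Rightarrow> complex \<times> complex \<times> complex" where
  "child_triangle p i (A, B, C) =
     (let M = p $ 1 *\<^sub>R A + p $ 2 *\<^sub>R B + p $ 3 *\<^sub>R C
      in if i = 1 then (M, B, C) else if i = 2 then (A, M, C) else (A, B, M))"

function vertices :: "(word3 \<Rightarrow> real ^ 3) \<Rightarrow> word3 \<Rightarrow> complex \<times> complex \<times> complex" where
  "vertices p [] = (0, 1, exp (\<i> * pi / 3))"
| "vertices p (u @ [i]) = child_triangle (p u) i (vertices p u)"
  by (auto, metis rev_exhaust)
termination by (relation "Wellfounded.measure (\<lambda>(p, u). length u)") auto

definition filled_triangle :: "(word3 \<Rightarrow> real ^ 3) \<Rightarrow> word3 \<Rightarrow> complex set" where
  "filled_triangle p u = (case vertices p u of (A, B, C) \<Rightarrow> convex hull {A, B, C})"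

definition root_triangle :: "complex set" where
  "root_triangle = convex hull {0, 1, exp (\<i> * pi / 3)}"

fun child_endpoints :: "real ^ 3 \<Rightarrow> 3 \<Rightarrow> real \<times> real \<Rightarrow> real \<times> real" where
  "child_endpoints y i (a, b) =
     (if i = 1 then (a, a + (b - a) * y $ 1)
      else if i = 2 then (a + (b - a) * y $ 1, a + (b - a) * (y $ 1 + y $ 2))
      else (a + (b - a) * (y $ 1 + y $ 2), b))"

function endpoints :: "(word3 \<Rightarrow> real ^ 3) \<Rightarrow> word3 \<Rightarrow> real \<times> real" where
  "endpoints y [] = (0, 1)"
| "endpoints y (u @ [i]) = child_endpoints (y u) i (endpoints y u)"
  by (auto, metis rev_exhaust)
termination by (relation "Wellfounded.measure (\<lambda>(y, u). length u)") auto

definition interval :: "(word3 \<Rightarrow> real ^ 3) \<Rightarrow> word3 \<Rightarrow> real set" where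
  "interval y u = (case endpoints y u of (a, b) \<Rightarrow> {a..<b})"

text \<open>
  Random measures on a compact set \<open>S\<close>; local finiteness then amounts to finiteness.
\<close>

definition random_measure_on ::
    "'w measure \<Rightarrow> complex set \<Rightarrow> ('w \<Rightarrow> complex measure) \<Rightarrow> bool" where
  "random_measure_on M S \<mu> \<longleftrightarrow>
     (\<forall>\<omega>\<in>space M. finite_measure (\<mu> \<omega>) \<and> sets (\<mu> \<omega>) = sets (restrict_space borel S)) \<and>
     (\<forall>E\<in>sets (restrict_space borel S). (\<lambda>\<omega>. emeasure (\<mu> \<omega>) E) \<in> borel_measurable M)"

end

theory Submission
  imports Defs
begin

text \<open>
  An atom at \<open>x\<close> lies, for each \<open>n\<close>, in some triangle \<open>T(u)\<close> with \<open>|u| = n\<close>, so its mass is at most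
  the length of \<open>I\<^sup>u\<close>, which is a product of \<open>n\<close> independent coordinates of the \<open>Y\<^sup>v\<close>. The sum
  \<open>S n\<close> of the squared lengths over the words of length \<open>n\<close> has expectation \<open>q ^ n\<close>, where
  \<open>q = E(y\<^sub>1\<^sup>2 + y\<^sub>2\<^sup>2 + y\<^sub>3\<^sup>2) < 1\<close> because the \<open>y\<^sub>i\<close> are positive with sum 1. Hence
  \<open>\<Sum>n. S n\<close> is a.s. finite, whereas an atom would bound \<open>S n\<close> away from 0.
\<close>

section \<open>Triangles\<close>

text \<open>If \<open>u / a\<close> is the smallest of the three ratios, subtracting
  \<open>u / a\<close> times the splitting point removes \<open>A\<close> from the combination and
  keeps the coefficients of \<open>B\<close> and \<open>C\<close> nonnegative.\<close>

lemma triangle_split_min: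
  fixes A B C :: "'a::real_vector"
  assumes p: "0 < a" "0 < b" "0 < c" "a + b + c = 1"
    and u: "0 \<le> u" "0 \<le> v" "0 \<le> w" "u + v + w = 1"
    and le: "u / a \<le> v / b" "u / a \<le> w / c"
  shows "u *\<^sub>R A + v *\<^sub>R B + w *\<^sub>R C \<in> convex hull {a *\<^sub>R A + b *\<^sub>R B + c *\<^sub>R C, B, C}"
proof -
  define t where "t = u / a"
  have ta: "t * a = u" using p by (simp add: t_def)
  have "t * b \<le> v" "t * c \<le> w" using le p by (simp_all add: t_def pos_le_divide_eq)
  moreover have "0 \<le> t" using p u by (simp add: t_def)
  moreover have "t + (v - t * b) + (w - t * c) = 1"
  proof -
    have "t * (a + b + c) = t" using p by simp
    then show ?thesis using ta u by (simp add: algebra_simps)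
  qed
  moreover have "u *\<^sub>R A + v *\<^sub>R B + w *\<^sub>R C =
      t *\<^sub>R (a *\<^sub>R A + b *\<^sub>R B + c *\<^sub>R C) + (v - t * b) *\<^sub>R B + (w - t * c) *\<^sub>R C"
    using ta by (simp add: algebra_simps)
  ultimately show ?thesis
    unfolding convex_hull_3 mem_Collect_eq by (metis diff_ge_0_iff_ge)
qed

text \<open>One of the ratios \<open>u / a\<close>, \<open>v / b\<close>, \<open>w / c\<close> is
  minimal; it names the vertex to be replaced by \<open>M\<close>, and permuting the vertices
  reduces to \<open>triangle_split_min\<close>.\<close>

lemma triangle_split:
  fixes A B C :: "'a::real_vector"
  assumes p: "0 < a" "0 < b" "0 < c" "a + b + c = 1"
    and x: "x \<in> convex hull {A, B, C}"
    and M: "M = a *\<^sub>R A + b *\<^sub>R B + c *\<^sub>R C"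
  shows "x \<in> convex hull {M, B, C} \<or> x \<in> convex hull {A, M, C} \<or> x \<in> convex hull {A, B, M}"
proof -
  obtain u v w where u: "0 \<le> u" "0 \<le> v" "0 \<le> w" "u + v + w = 1"
    and x': "x = u *\<^sub>R A + v *\<^sub>R B + w *\<^sub>R C"
    using x unfolding convex_hull_3 by auto
  consider "u / a \<le> v / b" "u / a \<le> w / c" | "v / b \<le> u / a" "v / b \<le> w / c"
    | "w / c \<le> u / a" "w / c \<le> v / b"
    by linarith
  then show ?thesis
  proof cases
    case 1
    then show ?thesis using triangle_split_min[OF p u, of A B C] x' M by simp
  next
    case 2
    then show ?thesis
      using triangle_split_min[of b a c v u w B A C] p u x' M by (simp add: ac_simps insert_commute)
  next
    case 3
    then show ?thesis
      using triangle_split_min[of c a b w u v C A B] p u x' M by (simp add: ac_simps insert_commute)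
  qed
qed

section \<open>Covering of the root triangle by the triangles of each generation\<close>

definition proper_splits :: "(word3 \<Rightarrow> real ^ 3) \<Rightarrow> bool" where
  "proper_splits p \<longleftrightarrow> (\<forall>u. (\<forall>i. 0 < p u $ i) \<and> p u $ 1 + p u $ 2 + p u $ 3 = 1)"

lemma proper_splitsD:
  assumes "proper_splits p"
  shows "0 < p u $ i" "p u $ 1 + p u $ 2 + p u $ 3 = 1"
  using assms by (simp_all add: proper_splits_def)

lemma filled_triangle_Nil: "filled_triangle p [] = root_triangle"
  by (simp add: filled_triangle_def root_triangle_def)

lemma filled_triangle_snoc_subset:
  assumes "proper_splits p"
  shows "filled_triangle p (u @ [i]) \<subseteq> filled_triangle p u"
proof -
  obtain A B C where v: "vertices p u = (A, B, C)" by (cases "vertices p u") auto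
  define M where "M = p u $ 1 *\<^sub>R A + p u $ 2 *\<^sub>R B + p u $ 3 *\<^sub>R C"
  have "M \<in> convex hull {A, B, C}"
    unfolding M_def convex_hull_3 mem_Collect_eq
    using proper_splitsD[OF assms, of u] by (metis less_imp_le)
  then have "{M, A, B, C} \<subseteq> convex hull {A, B, C}"
    using hull_subset[of "{A, B, C}" convex] by auto
  then have "convex hull D \<subseteq> convex hull {A, B, C}" if "D \<subseteq> {M, A, B, C}" for D
    using that by (meson convex_convex_hull hull_minimal order_trans)
  then show ?thesis
    by (auto simp: filled_triangle_def v Let_def M_def[symmetric] split: if_splits)
qed

lemma filled_triangle_subset_root:
  assumes "proper_splits p"
  shows "filled_triangle p u \<subseteq> root_triangle"
proof (induction u rule: rev_induct)
  case Nil
  then show ?case by (simp add: filled_triangle_Nil)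
next
  case (snoc i u)
  then show ?case using filled_triangle_snoc_subset[OF assms] by blast
qed

text \<open>The random measures live on the trace sigma-algebra of \<open>root_triangle\<close>, so
  a triangle must be contained in it as well as closed.\<close>

lemma filled_triangle_measurable:
  assumes "proper_splits p"
  shows "filled_triangle p u \<in> sets (restrict_space borel root_triangle)"
proof -
  obtain A B C where v: "vertices p u = (A, B, C)" by (cases "vertices p u") auto
  have "closed (filled_triangle p u)"
    by (simp add: filled_triangle_def v compact_imp_closed finite_imp_compact_convex_hull)
  moreover have "closed root_triangle"
    by (simp add: root_triangle_def compact_imp_closed finite_imp_compact_convex_hull)
  ultimately show ?thesis
    using filled_triangle_subset_root[OF assms, of u]
    by (simp add: sets_restrict_space_iff borel_closed)
qed

lemma filled_triangle_children_cover:
  assumes "proper_splits p" "x \<in> filled_triangle p u"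
  shows "\<exists>i. x \<in> filled_triangle p (u @ [i])"
proof -
  obtain A B C where v: "vertices p u = (A, B, C)" by (cases "vertices p u") auto
  define M where "M = p u $ 1 *\<^sub>R A + p u $ 2 *\<^sub>R B + p u $ 3 *\<^sub>R C"
  have "x \<in> convex hull {A, B, C}" using assms(2) by (simp add: filled_triangle_def v)
  with triangle_split[OF proper_splitsD(1)[OF assms(1)] proper_splitsD(1)[OF assms(1)]
      proper_splitsD(1)[OF assms(1)] proper_splitsD(2)[OF assms(1)] _ M_def]
  have "x \<in> convex hull {M, B, C} \<or> x \<in> convex hull {A, M, C} \<or> x \<in> convex hull {A, B, M}"
    by blast
  then have "x \<in> filled_triangle p (u @ [1]) \<or> x \<in> filled_triangle p (u @ [2])
      \<or> x \<in> filled_triangle p (u @ [3])"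
    by (simp add: filled_triangle_def v Let_def M_def[symmetric])
  then show ?thesis by blast
qed

text \<open>Closed triangles of one generation share edges, so \<open>u\<close> need not be unique;
  one such triangle per generation suffices to bound an atom.\<close>

lemma filled_triangle_cover:
  assumes "proper_splits p" "x \<in> root_triangle"
  shows "\<exists>u. length u = n \<and> x \<in> filled_triangle p u"
proof (induction n)
  case 0
  then show ?case using assms by (simp add: filled_triangle_Nil)
next
  case (Suc n)
  then show ?case
    using filled_triangle_children_cover[OF assms(1)] by (metis length_append_singleton)
qed

section \<open>Interval lengths\<close>

text \<open>The product runs along the path from the root to \<open>u\<close>: at the proper prefix
  \<open>take k u\<close> the letter \<open>u ! k\<close> is chosen. The value type is left general
  to serve lengths in the reals as well as squares and moments in \<open>ennreal\<close>.\<close>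

definition word_prod :: "(word3 \<Rightarrow> 3 \<Rightarrow> 'a::comm_monoid_mult) \<Rightarrow> word3 \<Rightarrow> 'a" where
  "word_prod f u = (\<Prod>k<length u. f (take k u) (u ! k))"

lemma word_prod_Nil [simp]: "word_prod f [] = 1"
  by (simp add: word_prod_def)

lemma word_prod_snoc [simp]: "word_prod f (u @ [i]) = word_prod f u * f u i"
  by (simp add: word_prod_def nth_append)

text \<open>Independence is stated for a family indexed by words, so the product is reindexed from
  positions to prefixes; the position is recovered as \<open>length v\<close>.\<close>

lemma word_prod_prefixes:
  "word_prod f u = (\<Prod>v\<in>(\<lambda>k. take k u) ` {..<length u}. f v (u ! length v))"
proof -
  have "inj_on (\<lambda>k. take k u) {..<length u}"
    by (rule inj_on_inverseI[where g = length]) simp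
  then show ?thesis by (simp add: word_prod_def prod.reindex)
qed

text \<open>Splitting off the last letter makes the sum over words of length \<open>n + 1\<close>
  factor by distributivity.\<close>

lemma sum_word_prod_const:
  fixes m :: "3 \<Rightarrow> 'a::comm_semiring_1"
  shows "(\<Sum>u | length u = n. word_prod (\<lambda>_. m) u) = (\<Sum>i\<in>UNIV. m i) ^ n"
proof (induction n)
  case 0
  then show ?case by simp
next
  case (Suc n)
  have "{u::word3. length u = Suc n} = (\<lambda>(u, i). u @ [i]) ` ({u. length u = n} \<times> UNIV)"
    by (force simp: length_Suc_conv_rev)
  moreover have "inj_on (\<lambda>(u::word3, i). u @ [i]) ({u. length u = n} \<times> UNIV)"
    by (auto simp: inj_on_def)
  ultimately have "(\<Sum>u | length u = Suc n. word_prod (\<lambda>_. m) u) =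
      (\<Sum>(u, i)\<in>{u. length u = n} \<times> UNIV. word_prod (\<lambda>_. m) u * m i)"
    by (simp add: sum.reindex case_prod_unfold)
  also have "\<dots> = (\<Sum>u | length u = n. word_prod (\<lambda>_. m) u) * (\<Sum>i\<in>UNIV. m i)"
    by (simp add: sum_product sum.cartesian_product)
  finally show ?case by (simp add: Suc.IH mult.commute)
qed

lemma endpoints_length:
  assumes "proper_splits y"
  shows "snd (endpoints y u) - fst (endpoints y u) = word_prod (\<lambda>v i. y v $ i) u"
proof (induction u rule: rev_induct)
  case Nil
  then show ?case by simp
next
  case (snoc i u)
  obtain a b where e: "endpoints y u = (a, b)" by (cases "endpoints y u") auto
  \<comment> \<open>The third child ends at \<open>b\<close> itself, so its length is
    \<open>(b - a) * y u $ 3\<close> only because the coordinates sum to 1.\<close>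
  have y3: "y u $ 3 = 1 - (y u $ 1 + y u $ 2)"
    using proper_splitsD(2)[OF assms, of u] by simp
  have "b - (a + (b - a) * (y u $ 1 + y u $ 2)) = (b - a) * y u $ 3"
    unfolding y3 by (simp add: algebra_simps)
  then show ?case
    using snoc exhaust_3[of i] by (auto simp: e distrib_left)
qed

lemma emeasure_interval:
  assumes "proper_splits y"
  shows "emeasure lborel (interval y u) = ennreal (word_prod (\<lambda>v i. y v $ i) u)"
proof -
  have "0 \<le> word_prod (\<lambda>v i. y v $ i) u"
    unfolding word_prod_def by (intro prod_nonneg ballI less_imp_le proper_splitsD(1) assms)
  then show ?thesis
    using endpoints_length[OF assms, of u]
    by (cases "endpoints y u") (simp add: interval_def)
qed

lemma emeasure_interval_power2:
  assumes "proper_splits y"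
  shows "(emeasure lborel (interval y u))\<^sup>2 = word_prod (\<lambda>v i. (ennreal (y v $ i))\<^sup>2) u"
proof -
  have "ennreal (word_prod (\<lambda>v i. y v $ i) u) = word_prod (\<lambda>v i. ennreal (y v $ i)) u"
    unfolding word_prod_def
    by (rule prod_ennreal[symmetric]) (simp add: less_imp_le proper_splitsD(1) assms)
  then show ?thesis
    by (simp add: emeasure_interval[OF assms] word_prod_def prod_power_distrib)
qed

section \<open>Second moments\<close>

lemma borel_measurable_vec_nth [measurable]:
  "(\<lambda>x :: 'a::euclidean_space ^ 'n. x $ i) \<in> borel_measurable borel"
  by (intro borel_measurable_continuous_onI continuous_intros)

text \<open>The density vanishes unless all coordinates are positive, and
  \<open>simplex_point\<close> makes them sum to 1 identically.\<close>

lemma AE_dirichlet_simplex: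
  "AE x in dirichlet \<alpha>. (\<forall>i. 0 < x $ i) \<and> x $ 1 + x $ 2 + x $ 3 = 1"
proof -
  have [measurable]: "simplex_point \<in> borel_measurable borel"
  proof -
    \<comment> \<open>As a combination of axis vectors the map is visibly continuous, hence
      Borel.\<close>
    have eq: "simplex_point = (\<lambda>z. fst z *\<^sub>R axis 1 1 + snd z *\<^sub>R axis 2 1
        + (1 - fst z - snd z) *\<^sub>R axis 3 1)"
      by (auto simp: fun_eq_iff simplex_point_def vec_eq_iff forall_3 axis_def)
    show ?thesis
      unfolding eq by (intro borel_measurable_continuous_onI continuous_intros)
  qed
  have dm: "(\<lambda>z. ennreal (dirichlet_density \<alpha> (simplex_point z))) \<in> borel_measurable lborel"
    unfolding dirichlet_density_def by measurable
  have "AE z in density lborel (\<lambda>z. ennreal (dirichlet_density \<alpha> (simplex_point z))).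
      (\<forall>i. 0 < simplex_point z $ i) \<and> simplex_point z $ 1 + simplex_point z $ 2 + simplex_point z $ 3 = 1"
    unfolding AE_density[OF dm]
    by (auto simp: dirichlet_density_def simplex_point_def split: if_splits)
  then show ?thesis
    unfolding dirichlet_def by (subst AE_distr_iff) auto
qed

text \<open>Expanding the square of the coordinate sum, which is 1, leaves strictly positive cross
  terms, so the squares sum to less than 1 almost surely. Integration over a probability space keeps
  the inequality strict.\<close>

lemma (in prob_space) nn_integral_sum_squares_less_1:
  fixes Z :: "'a \<Rightarrow> real ^ 3"
  assumes [measurable]: "random_variable borel Z"
    and Z: "AE \<omega> in M. (\<forall>i. 0 < Z \<omega> $ i) \<and> Z \<omega> $ 1 + Z \<omega> $ 2 + Z \<omega> $ 3 = 1"
  shows "(\<Sum>i\<in>UNIV. \<integral>\<^sup>+\<omega>. (ennreal (Z \<omega> $ i))\<^sup>2 \<partial>M) < 1"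
proof -
  have "AE \<omega> in M. (\<Sum>i\<in>UNIV. (ennreal (Z \<omega> $ i))\<^sup>2) < 1"
    using Z
  proof eventually_elim
    case (elim \<omega>)
    then have pos: "0 < Z \<omega> $ 1" "0 < Z \<omega> $ 2" "0 < Z \<omega> $ 3" by auto
    have "1 = (Z \<omega> $ 1 + Z \<omega> $ 2 + Z \<omega> $ 3)\<^sup>2" using elim by simp
    also have "\<dots> = (Z \<omega> $ 1)\<^sup>2 + (Z \<omega> $ 2)\<^sup>2 + (Z \<omega> $ 3)\<^sup>2
        + 2 * (Z \<omega> $ 1 * Z \<omega> $ 2 + Z \<omega> $ 1 * Z \<omega> $ 3 + Z \<omega> $ 2 * Z \<omega> $ 3)"
      by (simp add: power2_eq_square algebra_simps)
    finally have lt: "(Z \<omega> $ 1)\<^sup>2 + (Z \<omega> $ 2)\<^sup>2 + (Z \<omega> $ 3)\<^sup>2 < 1"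
      using pos by (smt (verit) mult_pos_pos)
    have "(\<Sum>i\<in>UNIV. (ennreal (Z \<omega> $ i))\<^sup>2) = ennreal ((Z \<omega> $ 1)\<^sup>2 + (Z \<omega> $ 2)\<^sup>2 + (Z \<omega> $ 3)\<^sup>2)"
      using pos by (simp add: sum_3 ennreal_power ennreal_plus)
    then show ?case using lt by (simp add: ennreal_less_one_iff del: ennreal_plus)
  qed
  then have lt: "AE \<omega> in M. (\<Sum>i\<in>UNIV. (ennreal (Z \<omega> $ i))\<^sup>2) < 1" .
  have "(\<integral>\<^sup>+\<omega>. (\<Sum>i\<in>UNIV. (ennreal (Z \<omega> $ i))\<^sup>2) \<partial>M) \<le> (\<integral>\<^sup>+\<omega>. 1 \<partial>M)"
    using lt by (intro nn_integral_mono_AE) (auto elim: eventually_mono)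
  then have fin: "(\<integral>\<^sup>+\<omega>. (\<Sum>i\<in>UNIV. (ennreal (Z \<omega> $ i))\<^sup>2) \<partial>M) \<noteq> \<infinity>"
    by (auto simp: emeasure_space_1 top_unique)
  \<comment> \<open>Strict monotonicity of the integral requires that the reverse inequality fail on
    a set that is not null.\<close>
  have "\<not> (AE \<omega> in M. 1 \<le> (\<Sum>i\<in>UNIV. (ennreal (Z \<omega> $ i))\<^sup>2))"
  proof
    assume "AE \<omega> in M. 1 \<le> (\<Sum>i\<in>UNIV. (ennreal (Z \<omega> $ i))\<^sup>2)"
    with lt have "AE \<omega> in M. False" by eventually_elim auto
    then show False by simp
  qed
  with lt fin have "(\<integral>\<^sup>+\<omega>. (\<Sum>i\<in>UNIV. (ennreal (Z \<omega> $ i))\<^sup>2) \<partial>M) < (\<integral>\<^sup>+\<omega>. 1 \<partial>M)"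
    by (intro nn_integral_less) (auto elim: eventually_mono)
  then show ?thesis by (simp add: nn_integral_sum emeasure_space_1)
qed

text \<open>The factors along a word sit at distinct prefixes, so independence turns the expected
  product into a product of moments. By the common law \<open>D\<close> these depend only on the
  letters, and \<open>sum_word_prod_const\<close> applies.\<close>

lemma (in prob_space) nn_integral_sum_word_prod:
  fixes Y :: "word3 \<Rightarrow> 'a \<Rightarrow> real ^ 3" and g :: "real \<Rightarrow> ennreal"
  assumes indep: "indep_vars (\<lambda>_. borel) Y UNIV"
    and distr: "\<And>u. distr M borel (Y u) = D"
    and g [measurable]: "g \<in> borel_measurable borel"
  shows "(\<integral>\<^sup>+\<omega>. (\<Sum>u | length u = n. word_prod (\<lambda>v i. g (Y v \<omega> $ i)) u) \<partial>M) =
    (\<Sum>i\<in>UNIV. \<integral>\<^sup>+x. g (x $ i) \<partial>D) ^ n"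
proof -
  have Y [measurable]: "random_variable borel (Y u)" for u
    using indep by (simp add: indep_vars_def)
  have m: "(\<integral>\<^sup>+\<omega>. g (Y v \<omega> $ i) \<partial>M) = (\<integral>\<^sup>+x. g (x $ i) \<partial>D)" for v i
    unfolding distr[of v, symmetric] by (subst nn_integral_distr) auto
  have "(\<integral>\<^sup>+\<omega>. word_prod (\<lambda>v i. g (Y v \<omega> $ i)) u \<partial>M) =
      word_prod (\<lambda>_ i. \<integral>\<^sup>+x. g (x $ i) \<partial>D) u" for u
  proof -
    \<comment> \<open>Each vector is composed with one coordinate fixed by its index. For
      \<open>v\<close> at least as long as \<open>u\<close> that coordinate is unspecified, which is
      harmless after restriction to proper prefixes of \<open>u\<close>.\<close>
    have "indep_vars (\<lambda>_. borel) (\<lambda>v \<omega>. g (Y v \<omega> $ (u ! length v))) UNIV"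
      by (rule indep_vars_compose2[OF indep]) simp
    then have "indep_vars (\<lambda>_. borel) (\<lambda>v \<omega>. g (Y v \<omega> $ (u ! length v)))
        ((\<lambda>k. take k u) ` {..<length u})"
      by (rule indep_vars_subset) simp
    then show ?thesis
      unfolding word_prod_prefixes by (subst indep_vars_nn_integral) (simp_all add: m)
  qed
  moreover have "(\<lambda>\<omega>. word_prod (\<lambda>v i. g (Y v \<omega> $ i)) u) \<in> borel_measurable M" for u
    unfolding word_prod_def by measurable
  ultimately show ?thesis by (simp add: nn_integral_sum sum_word_prod_const)
qed

text \<open>The series is an integral against counting measure on the naturals, under which a
  positive constant has infinite integral.\<close>

lemma suminf_ennreal_lower_bound_top:
  fixes f :: "nat \<Rightarrow> ennreal"
  assumes "0 < c" "\<And>n. c \<le> f n"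
  shows "(\<Sum>n. f n) = \<infinity>"
proof -
  have "\<infinity> = (\<integral>\<^sup>+n. c \<partial>count_space (UNIV :: nat set))"
    using assms(1) by (simp add: ennreal_mult_top)
  also have "\<dots> \<le> (\<integral>\<^sup>+n. f n \<partial>count_space UNIV)"
    using assms(2) by (intro nn_integral_mono)
  finally show ?thesis by (simp add: nn_integral_count_space_nat top_unique)
qed

theorem proposition4p8:
  fixes M :: "'w measure"
    and \<nu> :: "(real ^ 3) measure"
    and P Y :: "word3 \<Rightarrow> 'w \<Rightarrow> real ^ 3"
    and \<mu> :: "'w \<Rightarrow> complex measure"
  assumes "prob_space M"
    and "splitting_law \<nu>"
    and "prob_space.indep_vars M (\<lambda>_. borel) P UNIV"
    and "\<And>u. distr M borel (P u) = \<nu>"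
    and "prob_space.indep_vars M (\<lambda>_. borel) Y UNIV"
    and "\<And>u. distr M borel (Y u) = dirichlet (\<chi> i. 1 / 2)"
    and "prob_space.indep_var M
           (Pi\<^sub>M UNIV (\<lambda>_. borel)) (\<lambda>\<omega> u. P u \<omega>)
           (Pi\<^sub>M UNIV (\<lambda>_. borel)) (\<lambda>\<omega> u. Y u \<omega>)"
    and "random_measure_on M root_triangle \<mu>"
    and "AE \<omega> in M. \<forall>u.
           emeasure (\<mu> \<omega>) (filled_triangle (\<lambda>v. P v \<omega>) u) = emeasure lborel (interval (\<lambda>v. Y v \<omega>) u) \<and>
           emeasure (\<mu> \<omega>) (frontier (filled_triangle (\<lambda>v. P v \<omega>) u)) = 0"
  shows "AE \<omega> in M. \<not> (\<exists>x\<in>root_triangle. emeasure (\<mu> \<omega>) {x} > 0)"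
proof -
  interpret prob_space M by fact
  have Ym [measurable]: "random_variable borel (Y u)" for u
    using assms(5) by (simp add: indep_vars_def)
  have Pm [measurable]: "random_variable borel (P u)" for u
    using assms(3) by (simp add: indep_vars_def)
  have "AE \<omega> in M. (\<forall>i. 0 < P u \<omega> $ i) \<and> P u \<omega> $ 1 + P u \<omega> $ 2 + P u \<omega> $ 3 = 1" for u
  proof -
    have "AE x in distr M borel (P u). (\<forall>i. 0 < x $ i) \<and> x $ 1 + x $ 2 + x $ 3 = 1"
      using assms(2) unfolding assms(4) splitting_law_def by (simp add: AE_all_countable)
    then show ?thesis by (subst (asm) AE_distr_iff) auto
  qed
  then have P: "AE \<omega> in M. proper_splits (\<lambda>u. P u \<omega>)"
    by (simp add: proper_splits_def AE_all_countable)
  have Yu: "AE \<omega> in M. (\<forall>i. 0 < Y u \<omega> $ i) \<and> Y u \<omega> $ 1 + Y u \<omega> $ 2 + Y u \<omega> $ 3 = 1" for u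
  proof -
    have "AE x in distr M borel (Y u). (\<forall>i. 0 < x $ i) \<and> x $ 1 + x $ 2 + x $ 3 = 1"
      unfolding assms(6) by (rule AE_dirichlet_simplex)
    then show ?thesis by (subst (asm) AE_distr_iff) auto
  qed
  then have Y: "AE \<omega> in M. proper_splits (\<lambda>u. Y u \<omega>)"
    by (simp add: proper_splits_def AE_all_countable)

  define S where "S n \<omega> = (\<Sum>u | length u = n. word_prod (\<lambda>v i. (ennreal (Y v \<omega> $ i))\<^sup>2) u)"
    for n \<omega>
  have Sm [measurable]: "S n \<in> borel_measurable M" for n
    unfolding S_def word_prod_def by measurable
  define q where "q = (\<Sum>i\<in>UNIV. \<integral>\<^sup>+x. (ennreal (x $ i))\<^sup>2 \<partial>dirichlet (\<chi> i. 1 / 2))"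
  \<comment> \<open>The strict bound concerns a random vector on \<open>M\<close>, so the moments of
    the Dirichlet law are realised by \<open>Y []\<close>.\<close>
  have "q = (\<Sum>i\<in>UNIV. \<integral>\<^sup>+\<omega>. (ennreal (Y [] \<omega> $ i))\<^sup>2 \<partial>M)"
    unfolding q_def assms(6)[of "[]", symmetric] by (simp add: nn_integral_distr)
  then have "q < 1" using nn_integral_sum_squares_less_1[OF Ym Yu] by simp
  then obtain r where r: "0 \<le> r" "q = ennreal r" "r < 1"
    by (cases q) (auto simp: ennreal_less_one_iff)
  \<comment> \<open>Monotone convergence gives a geometric series with ratio below 1; a finite
    expectation then forces the random series to be finite almost surely.\<close>
  have "(\<integral>\<^sup>+\<omega>. (\<Sum>n. S n \<omega>) \<partial>M) = (\<Sum>n. q ^ n)"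
    unfolding S_def q_def
    by (subst nn_integral_suminf) (simp_all add: Sm[unfolded S_def]
        nn_integral_sum_word_prod[OF assms(5,6), of "\<lambda>t. (ennreal t)\<^sup>2"])
  also have "\<dots> \<noteq> \<infinity>"
    using r by (simp add: ennreal_power ennreal_suminf_neq_top summable_geometric)
  finally have "AE \<omega> in M. (\<Sum>n. S n \<omega>) \<noteq> \<infinity>"
    by (intro nn_integral_PInf_AE) simp_all
  then show ?thesis
    using P Y assms(9) AE_space
  proof eventually_elim
    case (elim \<omega>)
    have sets: "sets (\<mu> \<omega>) = sets (restrict_space borel root_triangle)"
      using assms(8) elim(5) by (simp add: random_measure_on_def)
    show ?case
    proof
      assume "\<exists>x\<in>root_triangle. emeasure (\<mu> \<omega>) {x} > 0"
      then obtain x where x: "x \<in> root_triangle" "emeasure (\<mu> \<omega>) {x} > 0" by blast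
      \<comment> \<open>The bound is uniform in \<open>n\<close>: the word \<open>u\<close> varies
        with the generation, but the squared mass of the atom does not.\<close>
      have "(emeasure (\<mu> \<omega>) {x})\<^sup>2 \<le> S n \<omega>" for n
      proof -
        obtain u where u: "length u = n" "x \<in> filled_triangle (\<lambda>v. P v \<omega>) u"
          using filled_triangle_cover[OF elim(2) x(1)] by blast
        have "emeasure (\<mu> \<omega>) {x} \<le> emeasure (\<mu> \<omega>) (filled_triangle (\<lambda>v. P v \<omega>) u)"
          using u filled_triangle_measurable[OF elim(2)] sets by (intro emeasure_mono) auto
        also have "\<dots> = emeasure lborel (interval (\<lambda>v. Y v \<omega>) u)" using elim(4) by blast
        finally have "(emeasure (\<mu> \<omega>) {x})\<^sup>2 \<le> (emeasure lborel (interval (\<lambda>v. Y v \<omega>) u))\<^sup>2"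
          by (intro power_mono) auto
        also have "\<dots> = word_prod (\<lambda>v i. (ennreal (Y v \<omega> $ i))\<^sup>2) u"
          by (rule emeasure_interval_power2[OF elim(3)])
        also have "\<dots> \<le> S n \<omega>"
          unfolding S_def using u(1) finite_lists_length_eq[of "UNIV :: 3 set" n]
          by (intro member_le_sum) auto
        finally show ?thesis .
      qed
      moreover have "0 < (emeasure (\<mu> \<omega>) {x})\<^sup>2" using x(2) by (simp add: zero_less_iff_neq_zero)
      ultimately have "(\<Sum>n. S n \<omega>) = \<infinity>" by (intro suminf_ennreal_lower_bound_top)
      with elim(1) show False by simp
    qed
  qed
qed

end
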